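(* Let $l\ge 1$ be an integer. Then, for all complex $s$ with $\operatorname{Re}(s)$ sufficiently large (depending on $l$), $$\sum_{n=1}^\infty \tilde A_l(n)\, n^{-s}=\frac{1}{(l+1)-l\,\zeta(s)},$$ where $\zeta$ is the Riemann zeta function, and for every integer $n\ge 2$, $$\tilde A_l(n)=\sum_{k=1}^{\Omega(n)} l^k\,\tilde f_k(n).$$
   Context: For an integer $l\ge 1$, an $l$-colored part is a pair $(d,c)$ with $d\ge 2$ an integer (its value) and $c\in\{1,\dots,l\}$ (its color). An ordered $l$-colored factorization of an integer $n\ge 2$ is a finite sequence of $l$-colored parts whose values have product $n$ (one-part sequences are included; repetitions are allowed). $\tilde A_l(n)$ is the number of ordered $l$-colored factorizations of $n$ (so at most $l$ colors are used), and $\tilde A_l(1)=1$. For $k\ge 1$, $\tilde f_k(n)$ is the number of (uncolored) ordered factorizations of $n$ into exactly $k$ parts, i.e. the number of $k$-tuples $(d_1,\dots,d_k)$ of integers $d_j\ge 2$ (not necessarily distinct) with $d_1\cdots d_k=n$. $\Omega(n)$ is the number of prime factors of $n$ counted with multiplicity. *)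

theory Defs
  imports
    "HOL-Complex_Analysis.Complex_Analysis"
    "HOL-Computational_Algebra.Computational_Algebra"
begin

definition colored_parts :: "nat \<Rightarrow> (nat \<times> nat) set" where
  "colored_parts l = {2..} \<times> {1..l}"

definition colored_factorizations :: "nat \<Rightarrow> nat \<Rightarrow> (nat \<times> nat) list set" where
  "colored_factorizations l n =
     {ps. ps \<noteq> [] \<and> set ps \<subseteq> colored_parts l \<and> prod_list (map fst ps) = n}"

definition A_tilde :: "nat \<Rightarrow> nat \<Rightarrow> nat" where
  "A_tilde l n = (if n = 1 then 1 else card (colored_factorizations l n))"

definition f_tilde :: "nat \<Rightarrow> nat \<Rightarrow> nat" where
  "f_tilde k n = card {ds :: nat list. length ds = k \<and> set ds \<subseteq> {2..} \<and> prod_list ds = n}"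

definition big_Omega :: "nat \<Rightarrow> nat" where
  "big_Omega n = size (prime_factorization n)"

(* This is the Riemann zeta function on the half-plane Re s > 1 only; elsewhere the
   series diverges and the value of the constant is meaningless. *)
definition zeta :: "complex \<Rightarrow> complex" where
  "zeta s = (\<Sum>n. of_nat (Suc n) powr (- s))"

lemma prod_list_ge_2:
  fixes ds :: "nat list"
  assumes "set ds \<subseteq> {2..}"
  shows "length ds < prod_list ds" and "\<forall>d\<in>set ds. d \<le> prod_list ds"
proof -
  have "length ds < prod_list ds \<and> (\<forall>d\<in>set ds. d \<le> prod_list ds)"
    using assms
  proof (induction ds)
    case Nil
    then show ?case by simp
  next
    case (Cons d ds)
    then have d: "d \<ge> 2" and IH: "length ds < prod_list ds" "\<forall>d\<in>set ds. d \<le> prod_list ds"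
      by auto
    have 1: "2 * prod_list ds \<le> d * prod_list ds"
      using d by (rule mult_le_mono1)
    have 2: "d * 1 \<le> d * prod_list ds"
      using IH(1) by (intro mult_le_mono2) linarith
    have "\<forall>x\<in>set ds. x \<le> d * prod_list ds"
    proof
      fix x assume "x \<in> set ds"
      then have "x \<le> prod_list ds" using IH(2) by blast
      then show "x \<le> d * prod_list ds" using 1 by linarith
    qed
    moreover have "Suc (length ds) < d * prod_list ds"
      using 1 IH(1) by linarith
    ultimately show ?case using 2 by simp
  qed
  then show "length ds < prod_list ds" and "\<forall>d\<in>set ds. d \<le> prod_list ds"
    by blast+
qed

lemma finite_colored_factorizations: "finite (colored_factorizations l n)"
proof (rule finite_subset)
  show "colored_factorizations l n
          \<subseteq> {ps. set ps \<subseteq> {2..n} \<times> {1..l} \<and> length ps \<le> n}"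
  proof
    fix ps assume "ps \<in> colored_factorizations l n"
    then have ps: "set ps \<subseteq> {2..} \<times> {1..l}" and prod: "prod_list (map fst ps) = n"
      by (auto simp: colored_factorizations_def colored_parts_def)
    have "set (map fst ps) \<subseteq> {2..}"
      using ps by auto
    from prod_list_ge_2[OF this] prod have "length ps < n" "\<forall>p\<in>set ps. fst p \<le> n"
      by auto
    then show "ps \<in> {ps. set ps \<subseteq> {2..n} \<times> {1..l} \<and> length ps \<le> n}"
      using ps by fastforce
  qed
  show "finite {ps. set ps \<subseteq> {2..n} \<times> {1..l} \<and> length ps \<le> n}"
    by (rule finite_lists_length_le) simp
qed

lemma finite_ordered_factorizations:
  "finite {ds :: nat list. length ds = k \<and> set ds \<subseteq> {2..} \<and> prod_list ds = n}"
proof (rule finite_subset)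
  show "{ds :: nat list. length ds = k \<and> set ds \<subseteq> {2..} \<and> prod_list ds = n}
          \<subseteq> {ds. set ds \<subseteq> {..n} \<and> length ds = k}"
    using prod_list_ge_2(2) by auto
  show "finite {ds. set ds \<subseteq> {..n} \<and> length ds = k}"
    by (rule finite_lists_length_eq) simp
qed

end

theory Submission
  imports Defs
begin

text \<open>
  Both claims come from sorting finite lists of parts in two ways.

  Give the coloured part \<open>(d, c)\<close> the weight \<open>d\<^sup>-\<^sup>s\<close>, and a list of parts the product of the weights
  of its entries, which is the product of its values raised to the power \<open>-s\<close>. The weights of the
  single parts have the sum \<open>S = l (\<zeta>(s) - 1)\<close>. Sorted by length, the lists contribute \<open>S\<^sup>k\<close> for each
  \<open>k\<close>, hence \<open>1 / (1 - S)\<close> altogether (\<open>has_sum_prod_list_lists\<close>); and \<open>1 - S = (l + 1) - l \<zeta>(s)\<close>.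
  Sorted by the product \<open>n\<close> of the values, they contribute \<open>A_tilde l n * n\<^sup>-\<^sup>s\<close> for each \<open>n\<close>, where
  the empty list accounts for the convention \<open>A_tilde l 1 = 1\<close>. The two sums agree because the family
  of all lists is absolutely summable as soon as the absolute values of the weights of the parts sum
  to less than 1. That sum is \<open>l\<close> times the tail \<open>2\<^sup>-\<^sup>x + 3\<^sup>-\<^sup>x + \<dots>\<close> with \<open>x = Re s\<close>, which tends to
  0 as \<open>x\<close> grows (\<open>zeta_tail_small\<close>). The same bound gives \<open>S \<noteq> 1\<close>.

  The formula for \<open>A_tilde l n\<close> sorts the factorizations of \<open>n\<close> by their number \<open>k\<close> of parts: values
  and colours can be chosen independently (\<open>card_colored_factorizations_length\<close>), and each value uses
  up at least one of the \<open>\<Omega>(n)\<close> prime factors of \<open>n\<close> (\<open>length_le_big_Omega\<close>).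
\<close>

section \<open>Sums of products over lists\<close>

text \<open>
  A list of length \<open>k + 1\<close> is a pair of a head and a list of length \<open>k\<close>, so this is the product of
  absolutely convergent series, iterated. The norms are carried through the induction because their
  sum justifies the interchange of summations in the step.
\<close>

lemma has_sum_prod_list_length:
  fixes w :: "'a \<Rightarrow> 'b :: {real_normed_field, banach}"
  assumes w: "(w has_sum S) A" and norm_w: "((\<lambda>x. norm (w x)) has_sum N) A"
  shows "((\<lambda>xs. prod_list (map w xs)) has_sum S ^ k) {xs. set xs \<subseteq> A \<and> length xs = k}"
    and "((\<lambda>xs. norm (prod_list (map w xs))) has_sum N ^ k) {xs. set xs \<subseteq> A \<and> length xs = k}"
proof -
  define L where "L k = {xs. set xs \<subseteq> A \<and> length xs = k}" for k
  define P where "P xs = prod_list (map w xs)" for xs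
  have "(P has_sum S ^ k) (L k) \<and> ((\<lambda>xs. norm (P xs)) has_sum N ^ k) (L k)"
  proof (induction k)
    case 0
    have "L 0 = {[]}" by (auto simp: L_def)
    then show ?case by (simp add: P_def has_sum_finite_iff)
  next
    case (Suc k)
    have bij: "bij_betw (\<lambda>(x, xs). x # xs) (A \<times> L k) (L (Suc k))"
      by (auto simp: bij_betw_def inj_on_def L_def image_iff length_Suc_conv)
    have P_Cons: "P (case p of (x, xs) \<Rightarrow> x # xs) = w (fst p) * P (snd p)" for p
      by (auto simp: P_def split: prod.split)
    have norm_inner: "((\<lambda>xs. norm (w (fst (x, xs)) * P (snd (x, xs)))) has_sum norm (w x) * N ^ k) (L k)" for x
      using has_sum_cmult_right[OF conjunct2[OF Suc.IH], of "norm (w x)"] by (simp add: norm_mult)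
    have norm_outer: "((\<lambda>x. norm (w x) * N ^ k) has_sum N * N ^ k) A"
      by (rule has_sum_cmult_left[OF norm_w])
    have norm_summable: "(\<lambda>p. norm (w (fst p) * P (snd p))) summable_on A \<times> L k"
      by (rule summable_on_SigmaI[OF norm_inner]) (use norm_outer in \<open>auto simp: summable_on_def\<close>)
    have "((\<lambda>p. norm (w (fst p) * P (snd p))) has_sum N * N ^ k) (A \<times> L k)"
      by (rule has_sum_SigmaI[OF norm_inner norm_outer norm_summable])
    then have 1: "((\<lambda>xs. norm (P xs)) has_sum N ^ Suc k) (L (Suc k))"
      by (subst has_sum_reindex_bij_betw[OF bij, symmetric]) (simp add: P_Cons)
    have "((\<lambda>p. w (fst p) * P (snd p)) has_sum S * S ^ k) (A \<times> L k)"
    proof (rule has_sum_SigmaI)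
      show "((\<lambda>xs. w (fst (x, xs)) * P (snd (x, xs))) has_sum w x * S ^ k) (L k)" for x
        using has_sum_cmult_right[OF conjunct1[OF Suc.IH], of "w x"] by simp
      show "((\<lambda>x. w x * S ^ k) has_sum S * S ^ k) A"
        by (rule has_sum_cmult_left[OF w])
      show "(\<lambda>p. w (fst p) * P (snd p)) summable_on A \<times> L k"
        using norm_summable by (rule abs_summable_summable)
    qed
    then have "(P has_sum S ^ Suc k) (L (Suc k))"
      by (subst has_sum_reindex_bij_betw[OF bij, symmetric]) (simp add: P_Cons)
    with 1 show ?case by simp
  qed
  then show "((\<lambda>xs. prod_list (map w xs)) has_sum S ^ k) {xs. set xs \<subseteq> A \<and> length xs = k}"
    and "((\<lambda>xs. norm (prod_list (map w xs))) has_sum N ^ k) {xs. set xs \<subseteq> A \<and> length xs = k}"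
    by (simp_all add: L_def P_def[abs_def])
qed

text \<open>The geometric series \<open>1 + S + S\<^sup>2 + \<dots>\<close>, expanded into words over \<open>A\<close>.\<close>

lemma has_sum_prod_list_lists:
  fixes w :: "'a \<Rightarrow> 'b :: {real_normed_field, banach}"
  assumes w: "(w has_sum S) A" and norm_w: "((\<lambda>x. norm (w x)) has_sum N) A" and "N < 1"
  shows "((\<lambda>xs. prod_list (map w xs)) has_sum 1 / (1 - S)) (lists A)"
proof -
  define L where "L k = {xs. set xs \<subseteq> A \<and> length xs = k}" for k
  have "N \<ge> 0" using norm_w by (rule has_sum_nonneg) simp
  have "norm S \<le> N" by (rule norm_has_sum_bound[OF norm_w w])
  with \<open>N < 1\<close> have "norm S < 1" by simp
  have bij: "bij_betw snd (Sigma UNIV L) (lists A)"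
    by (auto simp: bij_betw_def inj_on_def L_def image_iff)
  have "(\<lambda>p. norm (prod_list (map w (snd p)))) summable_on Sigma UNIV L"
  proof (rule summable_on_SigmaI)
    show "((\<lambda>xs. norm (prod_list (map w (snd (k, xs))))) has_sum N ^ k) (L k)" for k
      using has_sum_prod_list_length(2)[OF w norm_w, of k] by (simp add: L_def)
    show "(\<lambda>k. N ^ k) summable_on UNIV"
      using \<open>N \<ge> 0\<close> \<open>N < 1\<close> by (intro summable_nonneg_imp_summable_on) auto
  qed auto
  then have summable: "(\<lambda>p. prod_list (map w (snd p))) summable_on Sigma UNIV L"
    by (rule abs_summable_summable)
  have "((\<lambda>p. prod_list (map w (snd p))) has_sum 1 / (1 - S)) (Sigma UNIV L)"
  proof (rule has_sum_SigmaI[OF _ _ summable])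
    show "((\<lambda>xs. prod_list (map w (snd (k, xs)))) has_sum S ^ k) (L k)" for k
      using has_sum_prod_list_length(1)[OF w norm_w, of k] by (simp add: L_def)
    show "((\<lambda>k. S ^ k) has_sum 1 / (1 - S)) UNIV"
      using \<open>norm S < 1\<close>
      by (intro norm_summable_imp_has_sum geometric_sums) (auto simp: norm_power)
  qed
  then show ?thesis
    using has_sum_reindex_bij_betw[OF bij, of "\<lambda>xs. prod_list (map w xs)"] by simp
qed

section \<open>The series of the zeta function without its first term\<close>

lemma norm_of_nat_powr: "norm (of_nat n powr s :: complex) = real n powr Re s"
  by (subst norm_powr_real_powr) auto

lemma summable_on_powr_from_2:
  assumes "x > 1"
  shows "(\<lambda>d. real d powr (- x)) summable_on {2..}"
proof -
  have "(\<lambda>d. real d powr (- x)) summable_on UNIV"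
    using assms by (intro summable_nonneg_imp_summable_on) (auto simp: summable_real_powr_iff)
  then show ?thesis by (rule summable_on_subset_banach) simp
qed

lemma has_sum_zeta_from_2:
  assumes "Re s > 1"
  shows "((\<lambda>d. of_nat d powr (- s)) has_sum (zeta s - 1)) {2..}"
proof -
  define f where "f n = (of_nat (Suc n) :: complex) powr (- s)" for n
  have "summable (\<lambda>n. real n powr (- Re s))"
    using assms by (simp add: summable_real_powr_iff)
  then have "summable (\<lambda>n. real (Suc n) powr (- Re s))"
    by (subst summable_Suc_iff)
  then have norm_summable: "summable (\<lambda>n. norm (f n))"
    unfolding f_def norm_of_nat_powr by simp
  then have "f sums (\<Sum>n. f n)"
    by (rule summable_sums[OF summable_norm_cancel])
  then have "f sums zeta s"
    by (simp add: zeta_def f_def[abs_def])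
  then have "(f has_sum zeta s) UNIV"
    by (rule norm_summable_imp_has_sum[OF norm_summable])
  then have "(f has_sum (zeta s - (\<Sum>n\<in>{0}. f n))) (UNIV - {0})"
    by (intro has_sum_Diff has_sum_finite) auto
  moreover have "UNIV - {0} = {1::nat..}" by auto
  moreover have "f 0 = 1" by (simp add: f_def)
  ultimately have 1: "(f has_sum (zeta s - 1)) {1..}" by simp
  have bij: "bij_betw Suc {1..} {2..}"
    by (rule bij_betw_byWitness[where f' = "\<lambda>n. n - 1"]) auto
  from 1 show ?thesis
    unfolding f_def[abs_def] by (subst (asm) has_sum_reindex_bij_betw[OF bij])
qed

text \<open>
  For \<open>x > 2\<close>, replacing \<open>d\<^sup>-\<^sup>2\<close> by \<open>d\<^sup>-\<^sup>x\<close> divides every term by at least \<open>2 powr (x - 2)\<close>, because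
  \<open>d \<ge> 2\<close>. The series is therefore at most \<open>2 powr (2 - x)\<close> times its value at \<open>x = 2\<close>.
\<close>

lemma zeta_tail_small:
  fixes a :: real
  assumes "a \<ge> 0"
  obtains \<sigma> where "\<sigma> \<ge> 1" and "\<And>x. x > \<sigma> \<Longrightarrow> a * (\<Sum>\<^sub>\<infinity>d\<in>{2..}. real d powr (- x)) < 1"
proof -
  define C where "C = (\<Sum>\<^sub>\<infinity>d\<in>{2..}. real d powr (- 2))"
  have C: "C \<ge> 0" unfolding C_def by (rule infsum_nonneg) simp
  \<comment> \<open>chosen so that \<open>x > \<sigma>\<close> gives \<open>2 powr (x - 2) > 1 + a * C\<close>\<close>
  define \<sigma> where "\<sigma> = 2 + log 2 (1 + a * C)"
  have "a * C \<ge> 0" using assms C by simp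
  then have "\<sigma> \<ge> 2" by (simp add: \<sigma>_def)
  have "a * (\<Sum>\<^sub>\<infinity>d\<in>{2..}. real d powr (- x)) < 1" if "x > \<sigma>" for x
  proof -
    have "x > 2" using that \<open>\<sigma> \<ge> 2\<close> by simp
    have "(\<Sum>\<^sub>\<infinity>d\<in>{2..}. real d powr (- x)) \<le> (\<Sum>\<^sub>\<infinity>d\<in>{2..}. 2 powr (2 - x) * real d powr (- 2))"
    proof (rule infsum_mono)
      show "(\<lambda>d. real d powr (- x)) summable_on {2..}"
        using \<open>x > 2\<close> by (intro summable_on_powr_from_2) simp
      show "(\<lambda>d. 2 powr (2 - x) * real d powr (- 2)) summable_on {2..}"
        by (intro summable_on_cmult_right summable_on_powr_from_2) simp
      fix d :: nat
      assume d: "d \<in> {2..}"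
      have "real d powr (- x) = real d powr (2 - x) * real d powr (- 2)"
        by (simp flip: powr_add)
      also have "\<dots> \<le> 2 powr (2 - x) * real d powr (- 2)"
        using d \<open>x > 2\<close> by (intro mult_right_mono powr_mono2') auto
      finally show "real d powr (- x) \<le> 2 powr (2 - x) * real d powr (- 2)" .
    qed
    also have "\<dots> = C * 2 powr (2 - x)"
      unfolding C_def by (subst infsum_cmult_right') simp
    finally have "a * (\<Sum>\<^sub>\<infinity>d\<in>{2..}. real d powr (- x)) \<le> a * C * 2 powr (2 - x)"
      using assms by (simp add: mult_left_mono mult.assoc)
    also have "\<dots> = a * C / 2 powr (x - 2)"
      by (simp add: powr_diff)
    also have "\<dots> < 1"
    proof -
      have "log 2 (1 + a * C) < x - 2" using that by (simp add: \<sigma>_def)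
      then have "1 + a * C < 2 powr (x - 2)"
        using \<open>a * C \<ge> 0\<close> by (subst (asm) log_less_iff) auto
      then show ?thesis by simp
    qed
    finally show ?thesis .
  qed
  with \<open>\<sigma> \<ge> 2\<close> show ?thesis by (intro that[of \<sigma>]) auto
qed

section \<open>The Dirichlet series\<close>

lemma has_sum_colored_parts:
  fixes g :: "nat \<Rightarrow> 'b :: {real_normed_field, banach}"
  assumes g: "(g has_sum S) {2..}" and norm_g: "(\<lambda>d. norm (g d)) summable_on {2..}"
  shows "((\<lambda>p. g (fst p)) has_sum of_nat l * S) (colored_parts l)"
  unfolding colored_parts_def
proof (rule has_sum_SigmaI)
  show "((\<lambda>c. g (fst (d, c))) has_sum of_nat l * g d) {1..l}" for d
    by (rule has_sum_finiteI) auto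
  show "((\<lambda>d. of_nat l * g d) has_sum of_nat l * S) {2..}"
    by (rule has_sum_cmult_right[OF g])
  have "(\<lambda>p. norm (g (fst p))) summable_on {2..} \<times> {1..l}"
  proof (rule summable_on_SigmaI)
    show "((\<lambda>c. norm (g (fst (d, c)))) has_sum of_nat l * norm (g d)) {1..l}" for d
      by (rule has_sum_finiteI) auto
    show "(\<lambda>d. of_nat l * norm (g d)) summable_on {2..}"
      by (rule summable_on_cmult_right[OF norm_g])
  qed auto
  then show "(\<lambda>p. g (fst p)) summable_on {2..} \<times> {1..l}"
    by (rule abs_summable_summable)
qed

lemma prod_list_of_nat_powr:
  "prod_list (map (\<lambda>p. of_nat (fst p) powr s) ps) = (of_nat (prod_list (map fst ps)) :: complex) powr s"
  by (induction ps) (auto simp: powr_times_real)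

lemma colored_factorizations_conv_lists:
  "colored_factorizations l n =
     {ps \<in> lists (colored_parts l). prod_list (map fst ps) = n} - {[]}"
  by (auto simp: colored_factorizations_def)

text \<open>
  The empty list has product 1, and it is the only such list, so the value \<open>A_tilde l 1 = 1\<close> is what
  makes this formula uniform in \<open>n\<close>.
\<close>

lemma card_lists_colored_parts:
  "card {ps \<in> lists (colored_parts l). prod_list (map fst ps) = n} = A_tilde l n"
proof (cases "n = 1")
  case True
  have "ps = []" if "ps \<in> lists (colored_parts l)" "prod_list (map fst ps) = 1" for ps
    using prod_list_ge_2(1)[of "map fst ps"] that by (fastforce simp: colored_parts_def)
  then have "{ps \<in> lists (colored_parts l). prod_list (map fst ps) = n} = {[]}"
    using True by auto
  then show ?thesis using True by (simp add: A_tilde_def)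
next
  case False
  then have "[] \<notin> {ps \<in> lists (colored_parts l). prod_list (map fst ps) = n}"
    by simp
  with False show ?thesis
    by (simp add: A_tilde_def colored_factorizations_conv_lists)
qed

lemma finite_lists_colored_parts:
  "finite {ps \<in> lists (colored_parts l). prod_list (map fst ps) = n}"
  using finite_colored_factorizations[of l n]
  unfolding colored_factorizations_conv_lists by simp

text \<open>Any sum over lists of parts that depends only on the product becomes a sum over \<open>n\<close>.\<close>

lemma has_sum_A_tilde:
  fixes g :: "nat \<Rightarrow> complex"
  assumes "((\<lambda>ps. g (prod_list (map fst ps))) has_sum S) (lists (colored_parts l))"
  shows "((\<lambda>n. of_nat (A_tilde l n) * g n) has_sum S) {1..}"
proof -
  define F where "F n = {ps \<in> lists (colored_parts l). prod_list (map fst ps) = n}" for n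
  have "0 < prod_list (map fst ps)" if "ps \<in> lists (colored_parts l)" for ps
    using prod_list_ge_2(1)[of "map fst ps"] that by (fastforce simp: colored_parts_def)
  then have bij: "bij_betw snd (Sigma {1..} F) (lists (colored_parts l))"
    by (fastforce simp: bij_betw_def inj_on_def F_def image_iff)
  have "((\<lambda>p. g (prod_list (map fst (snd p)))) has_sum S) (Sigma {1..} F)"
    using has_sum_reindex_bij_betw[OF bij, of "\<lambda>ps. g (prod_list (map fst ps))"] assms by simp
  then show ?thesis
  proof (rule has_sum_Sigma')
    fix n
    show "((\<lambda>ps. g (prod_list (map fst (snd (n, ps))))) has_sum of_nat (A_tilde l n) * g n) (F n)"
      by (rule has_sum_finiteI)
        (auto simp: F_def finite_lists_colored_parts simp flip: card_lists_colored_parts)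
  qed
qed

lemma A_tilde_Dirichlet_series:
  assumes s: "Re s > 1"
    and small: "real l * (\<Sum>\<^sub>\<infinity>d\<in>{2..}. real d powr (- Re s)) < 1"
  shows "(of_nat l + 1) - of_nat l * zeta s \<noteq> 0"
    and "(\<lambda>n. of_nat (A_tilde l (Suc n)) * of_nat (Suc n) powr (- s))
           sums (1 / ((of_nat l + 1) - of_nat l * zeta s))"
proof -
  define w where "w p = (of_nat (fst p) :: complex) powr (- s)" for p :: "nat \<times> nat"
  define S where "S = of_nat l * (zeta s - 1)"
  define N where "N = real l * (\<Sum>\<^sub>\<infinity>d\<in>{2..}. real d powr (- Re s))"
  have S_eq: "1 - S = (of_nat l + 1) - of_nat l * zeta s"
    by (simp add: S_def algebra_simps)
  have summable: "(\<lambda>d. real d powr (- Re s)) summable_on {2..}"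
    by (rule summable_on_powr_from_2[OF s])
  have w: "(w has_sum S) (colored_parts l)"
    unfolding w_def[abs_def] S_def
    by (intro has_sum_colored_parts has_sum_zeta_from_2 s) (simp add: norm_of_nat_powr summable)
  have norm_w: "((\<lambda>p. norm (w p)) has_sum N) (colored_parts l)"
    using has_sum_colored_parts[OF has_sum_infsum[OF summable]] summable
    by (simp add: w_def norm_of_nat_powr N_def)
  have "N < 1" using small by (simp add: N_def)
  moreover have "norm S \<le> N" by (rule norm_has_sum_bound[OF norm_w w])
  ultimately show "(of_nat l + 1) - of_nat l * zeta s \<noteq> 0"
    by (auto simp flip: S_eq)
  have "((\<lambda>ps. prod_list (map w ps)) has_sum 1 / (1 - S)) (lists (colored_parts l))"
    using w norm_w \<open>N < 1\<close> by (rule has_sum_prod_list_lists)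
  then have "((\<lambda>ps. of_nat (prod_list (map fst ps)) powr (- s)) has_sum 1 / (1 - S)) (lists (colored_parts l))"
    unfolding w_def[abs_def] prod_list_of_nat_powr .
  then have 1: "((\<lambda>n. of_nat (A_tilde l n) * of_nat n powr (- s)) has_sum 1 / (1 - S)) {1..}"
    by (rule has_sum_A_tilde)
  have bij: "bij_betw Suc UNIV {1..}"
    by (rule bij_betw_byWitness[where f' = "\<lambda>n. n - 1"]) auto
  show "(\<lambda>n. of_nat (A_tilde l (Suc n)) * of_nat (Suc n) powr (- s))
          sums (1 / ((of_nat l + 1) - of_nat l * zeta s))"
    by (rule has_sum_imp_sums)
      (use 1 in \<open>simp only: has_sum_reindex_bij_betw[OF bij, symmetric] S_eq\<close>)
qed

section \<open>Factorizations by number of parts\<close>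

lemma length_le_big_Omega:
  assumes "set ds \<subseteq> {2..}"
  shows "length ds \<le> big_Omega (prod_list ds)"
  using assms
proof (induction ds)
  case (Cons d ds)
  then have "d \<ge> 2" "prod_list ds > 0"
    using prod_list_ge_2(1)[of ds] by auto
  have "prime_factorization d \<noteq> {#}"
    using \<open>d \<ge> 2\<close> by (auto simp: prime_factorization_empty_iff)
  then have "size (prime_factorization d) \<ge> 1"
    by (simp add: Suc_le_eq nonempty_has_size)
  moreover have "prime_factorization (d * prod_list ds) = prime_factorization d + prime_factorization (prod_list ds)"
    using \<open>d \<ge> 2\<close> \<open>prod_list ds > 0\<close> by (intro prime_factorization_mult) auto
  ultimately show ?case using Cons by (simp add: big_Omega_def)
qed simp

text \<open>Splitting a list of pairs into its values and its colours makes the two choices independent.\<close>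

lemma card_colored_factorizations_length:
  assumes "k \<ge> 1"
  shows "card {ps \<in> colored_factorizations l n. length ps = k} = l ^ k * f_tilde k n"
proof -
  define D where "D = {ds :: nat list. length ds = k \<and> set ds \<subseteq> {2..} \<and> prod_list ds = n}"
  define C where "C = {cs. set cs \<subseteq> {1..l} \<and> length cs = k}"
  have "bij_betw (\<lambda>ps. (map fst ps, map snd ps))
          {ps \<in> colored_factorizations l n. length ps = k} (D \<times> C)"
  proof (rule bij_betw_byWitness[where f' = "\<lambda>(ds, cs). zip ds cs"])
    show "(\<lambda>ps. (map fst ps, map snd ps)) ` {ps \<in> colored_factorizations l n. length ps = k} \<subseteq> D \<times> C"
      by (fastforce simp: D_def C_def colored_factorizations_def colored_parts_def)
    show "(\<lambda>(ds, cs). zip ds cs) ` (D \<times> C) \<subseteq> {ps \<in> colored_factorizations l n. length ps = k}"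
      using assms
      by (fastforce simp: D_def C_def colored_factorizations_def colored_parts_def
          dest: set_zip_leftD set_zip_rightD)
  qed (auto simp: zip_map_fst_snd D_def C_def)
  then have "card {ps \<in> colored_factorizations l n. length ps = k} = card D * card C"
    by (simp add: bij_betw_same_card card_cartesian_product)
  also have "card C = l ^ k"
    by (simp add: C_def card_lists_length_eq)
  finally show ?thesis by (simp add: D_def f_tilde_def)
qed

lemma A_tilde_eq_sum_f_tilde:
  assumes "n \<ge> 2"
  shows "A_tilde l n = (\<Sum>k = 1..big_Omega n. l ^ k * f_tilde k n)"
proof -
  have length_range: "length ps \<in> {1..big_Omega n}" if "ps \<in> colored_factorizations l n" for ps
  proof -
    from that have "set (map fst ps) \<subseteq> {2..}" "prod_list (map fst ps) = n" "ps \<noteq> []"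
      by (auto simp: colored_factorizations_def colored_parts_def)
    with length_le_big_Omega[of "map fst ps"] show ?thesis
      by (auto simp: Suc_le_eq)
  qed
  have "A_tilde l n = (\<Sum>ps\<in>colored_factorizations l n. 1)"
    using assms by (simp add: A_tilde_def)
  also have "\<dots> = (\<Sum>k = 1..big_Omega n. \<Sum>ps\<in>{ps \<in> colored_factorizations l n. length ps = k}. 1)"
    using length_range by (intro sum.group[symmetric] finite_colored_factorizations) auto
  also have "\<dots> = (\<Sum>k = 1..big_Omega n. l ^ k * f_tilde k n)"
    by (intro sum.cong) (simp_all add: card_colored_factorizations_length)
  finally show ?thesis .
qed

theorem theorem7:
  fixes l :: nat
  assumes "l \<ge> 1"
  shows "(\<exists>\<sigma>::real. \<sigma> \<ge> 1 \<and> (\<forall>s::complex. Re s > \<sigma> \<longrightarrow>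
            (of_nat l + 1) - of_nat l * zeta s \<noteq> 0 \<and>
            (\<lambda>n. of_nat (A_tilde l (Suc n)) * of_nat (Suc n) powr (- s))
              sums (1 / ((of_nat l + 1) - of_nat l * zeta s)))) \<and>
         (\<forall>n::nat. n \<ge> 2 \<longrightarrow>
            A_tilde l n = (\<Sum>k = 1..big_Omega n. l ^ k * f_tilde k n))"
proof -
  obtain \<sigma> where \<sigma>: "\<sigma> \<ge> 1"
    "\<And>x. x > \<sigma> \<Longrightarrow> real l * (\<Sum>\<^sub>\<infinity>d\<in>{2..}. real d powr (- x)) < 1"
    using zeta_tail_small[of "real l"] by auto
  have "(of_nat l + 1) - of_nat l * zeta s \<noteq> 0 \<and>
      (\<lambda>n. of_nat (A_tilde l (Suc n)) * of_nat (Suc n) powr (- s))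
        sums (1 / ((of_nat l + 1) - of_nat l * zeta s))" if "Re s > \<sigma>" for s
    using A_tilde_Dirichlet_series[of s l] \<sigma>(1) \<sigma>(2)[OF that] that by auto
  with \<sigma>(1) show ?thesis
    using A_tilde_eq_sum_f_tilde by blast
qed

end
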